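(* Let $n\ge 1$, let $A\in\mathbb{R}^{n\times n}$ be nonsingular, and let $\mathbf{v},\mathbf{w}\in\mathbb{R}^n$ be column vectors. Then $$\operatorname{adj}(A)\,\mathbf{v}=\operatorname{adj}(A+\mathbf{v}\mathbf{w}^T)\,\mathbf{v}.$$
   Context: $\operatorname{adj}(M)$ denotes the classical adjoint (adjugate) of a square matrix $M$, i.e. the transpose of its cofactor matrix, so $\operatorname{adj}(M)=\det(M)M^{-1}$ when $M$ is nonsingular. *)

theory Defs
  imports "Jordan_Normal_Form.Determinant"
begin

end

theory Submission
  imports Defs
begin

text \<open>
  By Laplace expansion, entry \<open>k\<close> of \<open>adj(M) v\<close> is the determinant of \<open>M\<close> with column \<open>k\<close>
  replaced by \<open>v\<close>. Replacing column \<open>k\<close> of \<open>A + v w\<^sup>T\<close> by \<open>v\<close> leaves the columns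
  \<open>a\<^sub>j + w\<^sub>j v\<close> for \<open>j \<noteq> k\<close>, which arise from \<open>A\<close> with column \<open>k\<close> replaced by \<open>v\<close> by adding
  multiples of column \<open>k\<close> to the others; this does not change the determinant.
\<close>

lemma adj_mat_mult_vec_index:
  fixes M :: "'a :: comm_ring_1 mat"
  assumes M: "M \<in> carrier_mat n n" and b: "b \<in> carrier_vec n" and k: "k < n"
  shows "(adj_mat M *\<^sub>v b) $ k = det (replace_col M b k)"
proof -
  have R: "replace_col M b k \<in> carrier_mat n n"
    using M by (auto simp: replace_col_def)
  have "(adj_mat M *\<^sub>v b) $ k = row (adj_mat M) k \<bullet> b"
    using adj_mat(1)[OF M] k by auto
  \<comment> \<open>Cofactors along column \<open>k\<close> do not see the entries of that column,
    so those of \<open>replace_col M b k\<close> are those of \<open>M\<close>, which form row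
    \<open>k\<close> of \<open>adj_mat M\<close>.\<close>
  also have "\<dots> = det (replace_col M b k)"
    unfolding scalar_prod_def using b k M
    by (subst laplace_expansion_column[OF R k], auto intro!: sum.cong arg_cong[of _ _ det]
      arg_cong[of _ _ "\<lambda>x. _ * x"] eq_matI
      simp: replace_col_def adj_mat_def Matrix.row_def cofactor_def mat_delete_def ac_simps)
  finally show ?thesis .
qed

text \<open>Expanding along column \<open>k\<close> leaves one cofactor, and its sign is +1 on the
  diagonal. This evaluates the determinant of the column-operation matrix \<open>E\<close>
  below.\<close>

lemma det_col_unit_vec:
  fixes E :: "'a :: comm_ring_1 mat"
  assumes E: "E \<in> carrier_mat n n" and k: "k < n" and col: "col E k = unit_vec n k"
  shows "det E = det (mat_delete E k k)"
proof -
  have Ek: "E $$ (i, k) = (if i = k then 1 else 0)" if "i < n" for i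
    using arg_cong[OF col, of "\<lambda>x. x $ i"] E k that by (auto simp: unit_vec_def)
  have "det E = (\<Sum>i<n. if i = k then cofactor E i k else 0)"
    unfolding laplace_expansion_column[OF E k] by (intro sum.cong) (auto simp: Ek)
  also have "\<dots> = cofactor E k k"
    using k by simp
  finally show ?thesis
    by (simp add: cofactor_def)
qed

lemma det_add_multiples_of_col:
  fixes B :: "'a :: comm_ring_1 mat"
  assumes B: "B \<in> carrier_mat n n" and k: "k < n"
  shows "det (mat n n (\<lambda>(i, j). if j = k then B $$ (i, k) else B $$ (i, j) + B $$ (i, k) * c j))
    = det B"
proof -
  \<comment> \<open>Right multiplication by \<open>E\<close> performs all the column operations at
    once: its entry \<open>c j\<close> in row \<open>k\<close> adds \<open>c j\<close> times column
    \<open>k\<close> to column \<open>j\<close>.\<close>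
  define E where "E = mat n n (\<lambda>(i, j). if i = j then 1 else if i = k then c j else 0)"
  have E: "E \<in> carrier_mat n n"
    by (simp add: E_def)
  \<comment> \<open>Row \<open>k\<close> holds all off-diagonal entries of \<open>E\<close>, so
    deleting it leaves an identity matrix.\<close>
  have "mat_delete E k k = 1\<^sub>m (n - 1)"
    by (rule eq_matI) (auto simp: mat_delete_def E_def)
  moreover have "col E k = unit_vec n k"
    using k by (auto simp: E_def)
  ultimately have detE: "det E = 1"
    using det_col_unit_vec[OF E k] by simp
  have "mat n n (\<lambda>(i, j). if j = k then B $$ (i, k) else B $$ (i, j) + B $$ (i, k) * c j) = B * E"
    (is "?L = _")
  proof (rule eq_matI)
    fix i j assume "i < dim_row (B * E)" "j < dim_col (B * E)"
    then have ij: "i < n" "j < n"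
      using B E by auto
    have "(B * E) $$ (i, j) = (\<Sum>l<n. B $$ (i, l) * E $$ (l, j))"
      using B E ij by (simp add: scalar_prod_def atLeast0LessThan)
    \<comment> \<open>Only \<open>l = j\<close> and \<open>l = k\<close> contribute. The inner test
      on \<open>j = k\<close> keeps the diagonal entry from being counted twice when they
      coincide.\<close>
    also have "\<dots> = (\<Sum>l<n. (if l = j then B $$ (i, l) else 0) +
        (if l = k then if j = k then 0 else B $$ (i, l) * c j else 0))"
      using ij by (intro sum.cong) (auto simp: E_def)
    also have "\<dots> = ?L $$ (i, j)"
      using ij k by (simp add: sum.distrib)
    finally show "?L $$ (i, j) = (B * E) $$ (i, j)" ..
  qed (use B E in auto)
  then show ?thesis
    using det_mult[OF B E] detE by simp
qed

lemma adj_mat_rank_one_update: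
  fixes A :: "'a :: comm_ring_1 mat"
  assumes A: "A \<in> carrier_mat n n" and v: "v \<in> carrier_vec n" and w: "w \<in> carrier_vec n"
  shows "adj_mat (A + mat_of_cols n [v] * (mat_of_cols n [w])\<^sup>T) *\<^sub>v v = adj_mat A *\<^sub>v v"
proof -
  define M where "M = A + mat_of_cols n [v] * (mat_of_cols n [w])\<^sup>T"
  have M: "M \<in> carrier_mat n n"
    unfolding M_def by (intro carrier_matI) simp_all
  have M_index: "M $$ (i, j) = A $$ (i, j) + v $ i * w $ j" if "i < n" "j < n" for i j
    using A that by (simp add: M_def scalar_prod_def mat_of_cols_index)
  have "adj_mat M *\<^sub>v v = adj_mat A *\<^sub>v v"
  proof (rule eq_vecI)
    fix k assume "k < dim_vec (adj_mat A *\<^sub>v v)"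
    then have k: "k < n"
      using adj_mat(1)[OF A] by simp
    let ?B = "replace_col A v k"
    have B: "?B \<in> carrier_mat n n"
      using A by (simp add: replace_col_def)
    \<comment> \<open>Column \<open>k\<close> of \<open>?B\<close> is \<open>v\<close>, so
      \<open>?B $$ (i, k) * w $ j\<close> is exactly the rank-one term in
      \<open>M $$ (i, j)\<close>.\<close>
    have "replace_col M v k = mat n n (\<lambda>(i, j). if j = k then ?B $$ (i, k)
        else ?B $$ (i, j) + ?B $$ (i, k) * w $ j)"
      using A M k by (intro eq_matI) (auto simp: replace_col_def M_index)
    then have "det (replace_col M v k) = det ?B"
      using det_add_multiples_of_col[OF B k] by simp
    then show "(adj_mat M *\<^sub>v v) $ k = (adj_mat A *\<^sub>v v) $ k"
      using adj_mat_mult_vec_index[OF _ v k] A M by simp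
  qed (use adj_mat(1)[OF A] adj_mat(1)[OF M] in simp)
  then show ?thesis
    by (simp add: M_def)
qed

theorem theorem1:
  fixes A :: "real mat" and v w :: "real vec" and n :: nat
  assumes "n \<ge> 1"
    and "A \<in> carrier_mat n n"
    and "invertible_mat A"
    and "v \<in> carrier_vec n"
    and "w \<in> carrier_vec n"
  shows "adj_mat A *\<^sub>v v
       = adj_mat (A + mat_of_cols n [v] * (mat_of_cols n [w])\<^sup>T) *\<^sub>v v"
  using adj_mat_rank_one_update[OF assms(2,4,5)] by simp

end
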